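(* Let $k \geq 1$ be an integer and let $\{\phi_j\}_j$ be a uniformly bounded orthonormal system of complex-valued functions on a probability space $(\Omega,\mu)$. If the $k$-fold tensor system $\{\Phi_j\}_j$ on $(\Omega^k,\mu^{\otimes k})$, $\Phi_j(x_1,\ldots,x_k)=\prod_{s=1}^k\phi_j(x_s)$, is Rademacher-Sidon, then the system $\{\phi_j\}_j$ is Rademacher-Sidon.
   Context: A uniformly bounded system $\{\phi_j\}$ on a probability space $\Omega$ is Rademacher-Sidon if there is a constant $\tilde\gamma>0$ such that $\int \sup_{x\in\Omega}|\sum_j r_j(\omega)a_j\phi_j(x)|\,d\omega \geq \tilde\gamma\sum_j|a_j|$ for all complex numbers $a_j$ (finitely many nonzero), where $r_1,r_2,\ldots$ are independent Rademacher functions (independent random variables taking the values $\pm1$ with probability $1/2$ each). "Uniformly bounded" means $\sup_j\|\phi_j\|_{L^\infty}<\infty$. *)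

theory Defs
  imports "HOL-Probability.Probability"
begin

definition Linfty_norm :: "'a measure \<Rightarrow> ('a \<Rightarrow> complex) \<Rightarrow> ennreal" where
  "Linfty_norm M f = esssup M (\<lambda>x. ennreal (cmod (f x)))"

definition uniformly_bounded_system :: "'a measure \<Rightarrow> ('i \<Rightarrow> 'a \<Rightarrow> complex) \<Rightarrow> bool" where
  "uniformly_bounded_system M \<phi> \<longleftrightarrow> (SUP j. Linfty_norm M (\<phi> j)) < \<infinity>"

definition orthonormal_system :: "'a measure \<Rightarrow> ('i \<Rightarrow> 'a \<Rightarrow> complex) \<Rightarrow> bool" where
  "orthonormal_system M \<phi> \<longleftrightarrow>
     (\<forall>j. \<phi> j \<in> borel_measurable M \<and> integrable M (\<lambda>x. (cmod (\<phi> j x))\<^sup>2)) \<and>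
     (\<forall>j l. (LINT x|M. \<phi> j x * cnj (\<phi> l x)) = (if j = l then 1 else 0))"

text \<open>The underlying probability space of a family of independent Rademacher functions:
  the infinite product of fair distributions on \<open>{-1, 1}\<close>. The Rademacher function
  with index \<open>j\<close> is the coordinate projection \<open>\<lambda>\<omega>. \<omega> j\<close>; the two lemmas below confirm that
  these are independent and take the values \<open>1\<close> and \<open>-1\<close> with probability \<open>1/2\<close> each.\<close>

definition rademacher_space :: "('i \<Rightarrow> real) measure" where
  "rademacher_space = (\<Pi>\<^sub>M j\<in>UNIV. measure_pmf (pmf_of_set {-1, 1 :: real}))"

lemma prob_space_rademacher_space: "prob_space rademacher_space"
  unfolding rademacher_space_def by (intro prob_space_PiM prob_space_measure_pmf)

lemma indep_rademacher:
  "prob_space.indep_vars (rademacher_space :: ('i \<Rightarrow> real) measure)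
     (\<lambda>_. count_space UNIV) (\<lambda>j \<omega>. \<omega> j) UNIV"
proof -
  interpret prob_space "rademacher_space :: ('i \<Rightarrow> real) measure"
    by (rule prob_space_rademacher_space)
  have rv: "(\<lambda>\<omega>. \<omega> j) \<in> rademacher_space \<rightarrow>\<^sub>M count_space UNIV" for j :: 'i
    unfolding rademacher_space_def
    using measurable_component_singleton[of j UNIV "\<lambda>_. measure_pmf (pmf_of_set {-1, 1 :: real})"]
    by simp
  have "distr rademacher_space (count_space UNIV) (\<lambda>\<omega>. \<omega> j) =
      measure_pmf (pmf_of_set {-1, 1 :: real})" for j :: 'i
  proof -
    have "distr rademacher_space (count_space UNIV) (\<lambda>\<omega>. \<omega> j) =
        distr rademacher_space (measure_pmf (pmf_of_set {-1, 1 :: real})) (\<lambda>\<omega>. \<omega> j)"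
      by (rule distr_cong) simp_all
    also have "\<dots> = measure_pmf (pmf_of_set {-1, 1 :: real})"
      unfolding rademacher_space_def
      by (rule distr_PiM_component) (simp_all add: prob_space_measure_pmf)
    finally show ?thesis .
  qed
  moreover have "distr rademacher_space (\<Pi>\<^sub>M j\<in>UNIV. count_space UNIV) (\<lambda>\<omega>. \<lambda>j\<in>UNIV. \<omega> j) =
      (rademacher_space :: ('i \<Rightarrow> real) measure)"
    unfolding rademacher_space_def restrict_UNIV
    by (intro distr_id2 sets_PiM_cong) simp_all
  ultimately show ?thesis
    using rv by (subst indep_vars_iff_distr_eq_PiM') (simp_all, simp add: rademacher_space_def)
qed

lemma prob_rademacher:
  assumes "c \<in> {-1, 1}"
  shows "measure rademacher_space {\<omega> \<in> space rademacher_space. \<omega> j = c} = 1 / 2"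
proof -
  let ?C = "measure_pmf (pmf_of_set {-1, 1 :: real})"
  have m: "(\<lambda>\<omega>. \<omega> j) \<in> rademacher_space \<rightarrow>\<^sub>M ?C"
    unfolding rademacher_space_def by (rule measurable_component_singleton) simp
  have "measure rademacher_space {\<omega> \<in> space rademacher_space. \<omega> j = c} =
      measure (distr rademacher_space ?C (\<lambda>\<omega>. \<omega> j)) {c}"
    by (subst measure_distr[OF m]) (auto intro!: arg_cong[where f = "measure _"])
  also have "distr rademacher_space ?C (\<lambda>\<omega>. \<omega> j) = ?C"
    unfolding rademacher_space_def by (rule distr_PiM_component) (simp_all add: prob_space_measure_pmf)
  also have "measure ?C {c} = 1 / 2"
    using assms by (auto simp: measure_pmf_single)
  finally show ?thesis .
qed

text \<open>The supremum over the space is the essential supremum, in agreement with the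
  \<open>L\<^sup>\<infinity>\<close>-norm in the definition of uniform boundedness, so that the notion does not depend
  on the values of the functions on null sets.\<close>

definition rademacher_sidon :: "'a measure \<Rightarrow> ('i \<Rightarrow> 'a \<Rightarrow> complex) \<Rightarrow> bool" where
  "rademacher_sidon M \<phi> \<longleftrightarrow>
     (\<exists>\<gamma>::real. \<gamma> > 0 \<and>
       (\<forall>a::'i \<Rightarrow> complex. finite {j. a j \<noteq> 0} \<longrightarrow>
         (\<integral>\<^sup>+ \<omega>. Linfty_norm M
            (\<lambda>x. \<Sum>j | a j \<noteq> 0. complex_of_real (\<omega> j) * a j * \<phi> j x) \<partial>rademacher_space)
         \<ge> ennreal (\<gamma> * (\<Sum>j | a j \<noteq> 0. cmod (a j)))))"

definition tensor_system :: "nat \<Rightarrow> ('i \<Rightarrow> 'a \<Rightarrow> complex) \<Rightarrow> 'i \<Rightarrow> (nat \<Rightarrow> 'a) \<Rightarrow> complex" where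
  "tensor_system k \<phi> j x = (\<Prod>s\<in>{1..k}. \<phi> j (x s))"

end

theory Submission
  imports Defs
begin

text \<open>
  Fix coefficients \<open>a\<close> with finite support \<open>J\<close>, let \<open>R\<close> be the expected sup norm of
  \<open>\<Sum>j. r\<^sub>j a\<^sub>j \<phi>\<^sub>j\<close>, and suppose that \<open>\<bar>\<phi>\<^sub>j\<bar> \<le> B\<close> with \<open>B \<ge> 1\<close>. What has to be bounded below is
  \<open>R\<close>, and the hypothesis bounds below the same quantity for the tensor system. So it is enough to
  see that replacing \<open>\<phi>\<^sub>j(x)\<close> by \<open>\<phi>\<^sub>j(x\<^sub>1) \<cdots> \<phi>\<^sub>j(x\<^sub>k)\<close> (with a harmless change of the phases of the
  coefficients) increases the expected supremum by at most a factor that depends on \<open>k\<close> and \<open>B\<close>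
  only.

  For Gaussian variables this would be a Slepian-type comparison. For Rademacher variables it
  follows from the contraction principle of Ledoux and Talagrand: if
  \<open>\<bar>u\<^sub>j(x) - u\<^sub>j(y)\<bar> \<le> \<bar>v\<^sub>j(x) - v\<^sub>j(y)\<bar>\<close> for all \<open>j\<close>, \<open>x\<close>, \<open>y\<close>, then
  \<open>E sup\<^sub>x \<Sum>j. r\<^sub>j u\<^sub>j(x) \<le> E sup\<^sub>x \<Sum>j. r\<^sub>j v\<^sub>j(x)\<close> (\<open>contraction_one_sided\<close>). The principle concerns one
  function per index while a tensor product combines several; the gap is closed by polarization,
  \<open>4 u v = (u + v)\<^sup>2 - (u - v)\<^sup>2\<close>. On the left of each square stands a sum, controlled by the triangle
  inequality, and squaring is Lipschitz on bounded sets, hence controlled by contraction. For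
  functions bounded by \<open>1\<close> this controls real products, then complex ones through real and imaginary
  parts, and then \<open>k\<close>-fold products by induction, with the factor \<open>32\<^sup>k\<close>
  (\<open>rademacher_sup_le_prod\<close>).

  As for the phases, the bounds for products are stated with nonnegative weights, so \<open>a\<^sub>j \<phi>\<^sub>j\<close> is written as
  \<open>\<bar>a\<^sub>j\<bar> \<cdot> (sgn a\<^sub>j \<cdot> \<phi>\<^sub>j)\<close>, where \<open>\<bar>a\<^sub>j\<bar>\<close> serves as a weight and the bracket is the bounded function
  to be multiplied. The product of the brackets carries the phase \<open>(sgn a\<^sub>j)\<^sup>k\<close>, and the hypothesis
  is applied to the coefficients \<open>\<bar>a\<^sub>j\<bar> (sgn a\<^sub>j / B)\<^sup>k\<close>, which all have modulus \<open>\<bar>a\<^sub>j\<bar> / B\<^sup>k\<close>.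

  Essential suprema turn into suprema over sets of full measure: only finitely many sign patterns
  and indices matter, so one null set of \<open>M\<close> can be discarded for all of them at once, and the
  points of \<open>\<Omega>\<^sup>k\<close> without a coordinate in it still have full measure.
\<close>

section \<open>Sign patterns\<close>

definition signs :: "'i set \<Rightarrow> ('i \<Rightarrow> real) set" where
  "signs J = (\<Pi>\<^sub>E j\<in>J. {-1, 1})"

lemma finite_signs [simp]: "finite J \<Longrightarrow> finite (signs J)"
  by (simp add: signs_def finite_PiE)

lemma sum_signs_insert:
  assumes "finite J" "j \<notin> J"
  shows "(\<Sum>\<epsilon>\<in>signs (insert j J). f \<epsilon>) = (\<Sum>\<epsilon>\<in>signs J. f (\<epsilon>(j := 1)) + f (\<epsilon>(j := -1)))"
proof -
  have inj: "inj_on (\<lambda>(y, g). g(j := y)) ({-1, 1 :: real} \<times> signs J)"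
    using inj_combinator[OF assms(2), of "\<lambda>_. {-1, 1 :: real}"] by (simp add: signs_def)
  have "signs (insert j J) = (\<lambda>(y, g). g(j := y)) ` ({-1, 1} \<times> signs J)"
    by (simp add: signs_def PiE_insert_eq)
  then have "(\<Sum>\<epsilon>\<in>signs (insert j J). f \<epsilon>) = (\<Sum>(y, g)\<in>{-1, 1} \<times> signs J. f (g(j := y)))"
    using sum.reindex[OF inj, of f] by (simp add: comp_def case_prod_unfold)
  also have "\<dots> = (\<Sum>y\<in>{-1, 1}. \<Sum>g\<in>signs J. f (g(j := y)))"
    by (simp add: sum.cartesian_product)
  finally show ?thesis
    by (simp add: sum.distrib add.commute)
qed

section \<open>The contraction principle for Rademacher sums\<close>

text \<open>
  The case of a single sign. The worst pair is at \<open>x\<close> for the sign \<open>+\<close> and at \<open>y\<close> for the sign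
  \<open>-\<close>, and there \<open>u x - u y \<le> \<bar>v x - v y\<bar>\<close>; depending on the sign of \<open>v x - v y\<close>, the bounds \<open>p\<close> and \<open>q\<close>
  are used at \<open>(x, y)\<close> or at \<open>(y, x)\<close>. The bounds \<open>p\<close> and \<open>q\<close> stand for the two suprema, which are
  thereby finite.
\<close>

lemma contraction_one_sign:
  fixes u v W :: "'x \<Rightarrow> real"
  assumes "\<And>x. x \<in> X \<Longrightarrow> W x + v x \<le> p" "\<And>x. x \<in> X \<Longrightarrow> W x - v x \<le> q"
    and lip: "\<And>x y. x \<in> X \<Longrightarrow> y \<in> X \<Longrightarrow> \<bar>u x - u y\<bar> \<le> \<bar>v x - v y\<bar>"
  shows "\<exists>p' q'. (\<forall>x\<in>X. W x + u x \<le> p' \<and> W x - u x \<le> q') \<and> p' + q' \<le> p + q"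
proof (cases "X = {}")
  case True
  then show ?thesis by auto
next
  case False
  have *: "(W x + u x) + (W y - u y) \<le> p + q" if "x \<in> X" "y \<in> X" for x y
    using assms(1)[of x] assms(1)[of y] assms(2)[of x] assms(2)[of y] lip[of x y] that by linarith
  let ?p = "SUP x\<in>X. W x + u x"
  have **: "?p \<le> p + q - (W y - u y)" if "y \<in> X" for y
    using False * that by (intro cSUP_least) (auto simp: algebra_simps)
  obtain y0 where "y0 \<in> X" using False by auto
  then have "bdd_above ((\<lambda>x. W x + u x) ` X)"
    using * by (intro bdd_aboveI[where M = "p + q - (W y0 - u y0)"]) (force simp: algebra_simps)
  then have "W x + u x \<le> ?p" if "x \<in> X" for x
    using that by (intro cSUP_upper)
  with ** show ?thesis
    by (intro exI[of _ ?p] exI[of _ "p + q - ?p"]) (force simp: algebra_simps)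
qed

text \<open>
  Here \<open>G\<close> and \<open>H\<close> are pointwise bounds for the suprema, so that the conclusion compares
  expectations. The free term \<open>w\<close> makes the induction on \<open>J\<close> work: for each choice of the remaining
  signs the new index is treated by \<open>contraction_one_sign\<close>, after which \<open>u j\<close> or \<open>- u j\<close> is absorbed
  into \<open>w\<close>.
\<close>

lemma contraction_one_sided:
  fixes u v :: "'i \<Rightarrow> 'x \<Rightarrow> real" and w :: "'x \<Rightarrow> real"
  assumes "finite J"
    and "\<And>\<epsilon> x. \<epsilon> \<in> signs J \<Longrightarrow> x \<in> X \<Longrightarrow> w x + (\<Sum>j\<in>J. \<epsilon> j * v j x) \<le> G \<epsilon>"
    and "\<And>j x y. j \<in> J \<Longrightarrow> x \<in> X \<Longrightarrow> y \<in> X \<Longrightarrow> \<bar>u j x - u j y\<bar> \<le> \<bar>v j x - v j y\<bar>"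
  shows "\<exists>H. (\<forall>\<epsilon>\<in>signs J. \<forall>x\<in>X. w x + (\<Sum>j\<in>J. \<epsilon> j * u j x) \<le> H \<epsilon>) \<and>
             sum H (signs J) \<le> sum G (signs J)"
  using assms
proof (induction J arbitrary: w G rule: finite_induct)
  case empty
  then show ?case by (intro exI[of _ G]) auto
next
  case (insert j J)
  have upd: "(\<Sum>i\<in>insert j J. (\<epsilon>(j := s)) i * v i x) = s * v j x + (\<Sum>i\<in>J. \<epsilon> i * v i x)"
    for \<epsilon> s x
  proof -
    have "(\<Sum>i\<in>J. (\<epsilon>(j := s)) i * v i x) = (\<Sum>i\<in>J. \<epsilon> i * v i x)"
      using insert.hyps by (intro sum.cong) auto
    then show ?thesis using insert.hyps by simp
  qed
  have mem: "\<epsilon>(j := 1) \<in> signs (insert j J)" "\<epsilon>(j := -1) \<in> signs (insert j J)" if "\<epsilon> \<in> signs J" for \<epsilon>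
    using that by (auto simp: signs_def PiE_iff extensional_def)
  have "\<exists>p' q'. (\<forall>x\<in>X. (w x + (\<Sum>i\<in>J. \<epsilon> i * v i x)) + u j x \<le> p' \<and>
                      (w x + (\<Sum>i\<in>J. \<epsilon> i * v i x)) - u j x \<le> q') \<and>
                p' + q' \<le> G (\<epsilon>(j := 1)) + G (\<epsilon>(j := -1))" if e: "\<epsilon> \<in> signs J" for \<epsilon>
  proof (rule contraction_one_sign[where v = "v j"])
    fix x assume "x \<in> X"
    show "w x + (\<Sum>i\<in>J. \<epsilon> i * v i x) + v j x \<le> G (\<epsilon>(j := 1))"
      using insert.prems(1)[OF mem(1)[OF e] \<open>x \<in> X\<close>] unfolding upd by linarith
    show "w x + (\<Sum>i\<in>J. \<epsilon> i * v i x) - v j x \<le> G (\<epsilon>(j := -1))"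
      using insert.prems(1)[OF mem(2)[OF e] \<open>x \<in> X\<close>] unfolding upd by linarith
  qed (use insert.prems in auto)
  then have "\<forall>\<epsilon>\<in>signs J. \<exists>p' q'. (\<forall>x\<in>X. (w x + (\<Sum>i\<in>J. \<epsilon> i * v i x)) + u j x \<le> p' \<and>
                      (w x + (\<Sum>i\<in>J. \<epsilon> i * v i x)) - u j x \<le> q') \<and>
                p' + q' \<le> G (\<epsilon>(j := 1)) + G (\<epsilon>(j := -1))"
    by blast
  then obtain p q where
    "\<forall>\<epsilon>\<in>signs J. (\<forall>x\<in>X. (w x + (\<Sum>i\<in>J. \<epsilon> i * v i x)) + u j x \<le> p \<epsilon> \<and>
                      (w x + (\<Sum>i\<in>J. \<epsilon> i * v i x)) - u j x \<le> q \<epsilon>) \<and>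
                p \<epsilon> + q \<epsilon> \<le> G (\<epsilon>(j := 1)) + G (\<epsilon>(j := -1))"
    unfolding bchoice_iff by (elim exE)
  then have pq:
    "\<And>\<epsilon> x. \<epsilon> \<in> signs J \<Longrightarrow> x \<in> X \<Longrightarrow> w x + (\<Sum>i\<in>J. \<epsilon> i * v i x) + u j x \<le> p \<epsilon>"
    "\<And>\<epsilon> x. \<epsilon> \<in> signs J \<Longrightarrow> x \<in> X \<Longrightarrow> w x + (\<Sum>i\<in>J. \<epsilon> i * v i x) - u j x \<le> q \<epsilon>"
    "\<And>\<epsilon>. \<epsilon> \<in> signs J \<Longrightarrow> p \<epsilon> + q \<epsilon> \<le> G (\<epsilon>(j := 1)) + G (\<epsilon>(j := -1))"
    by blast+
  have "\<exists>H. (\<forall>\<epsilon>\<in>signs J. \<forall>x\<in>X. (w x + u j x) + (\<Sum>i\<in>J. \<epsilon> i * u i x) \<le> H \<epsilon>) \<and>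
             sum H (signs J) \<le> sum p (signs J)"
    using pq(1) insert.prems(2) by (intro insert.IH) (auto simp: algebra_simps)
  then obtain P where P:
    "\<And>\<epsilon> x. \<epsilon> \<in> signs J \<Longrightarrow> x \<in> X \<Longrightarrow> (w x + u j x) + (\<Sum>i\<in>J. \<epsilon> i * u i x) \<le> P \<epsilon>"
    "sum P (signs J) \<le> sum p (signs J)" by auto
  have "\<exists>H. (\<forall>\<epsilon>\<in>signs J. \<forall>x\<in>X. (w x - u j x) + (\<Sum>i\<in>J. \<epsilon> i * u i x) \<le> H \<epsilon>) \<and>
             sum H (signs J) \<le> sum q (signs J)"
    using pq(2) insert.prems(2) by (intro insert.IH) (auto simp: algebra_simps)
  then obtain Q where Q:
    "\<And>\<epsilon> x. \<epsilon> \<in> signs J \<Longrightarrow> x \<in> X \<Longrightarrow> (w x - u j x) + (\<Sum>i\<in>J. \<epsilon> i * u i x) \<le> Q \<epsilon>"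
    "sum Q (signs J) \<le> sum q (signs J)" by auto
  (* the restriction to J matters because P and Q control sign patterns that are undefined at j *)
  define H where "H \<epsilon> = (if \<epsilon> j = 1 then P (restrict \<epsilon> J) else Q (restrict \<epsilon> J))" for \<epsilon>
  have res: "restrict \<epsilon> J = \<epsilon>" if "\<epsilon> \<in> signs J" for \<epsilon>
    using that by (auto simp: signs_def)
  have "sum H (signs (insert j J)) = sum P (signs J) + sum Q (signs J)"
    by (simp add: sum_signs_insert insert.hyps sum.distrib H_def res)
  also have "\<dots> \<le> (\<Sum>\<epsilon>\<in>signs J. p \<epsilon> + q \<epsilon>)"
    using P Q by (simp add: sum.distrib)
  also have "\<dots> \<le> sum G (signs (insert j J))"
    using pq(3) by (simp add: sum_signs_insert insert.hyps sum_mono)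
  finally have "sum H (signs (insert j J)) \<le> sum G (signs (insert j J))" .
  moreover have "w x + (\<Sum>i\<in>insert j J. \<epsilon> i * u i x) \<le> H \<epsilon>"
    if e: "\<epsilon> \<in> signs (insert j J)" and "x \<in> X" for \<epsilon> x
  proof -
    have r: "restrict \<epsilon> J \<in> signs J" and "\<epsilon> j = 1 \<or> \<epsilon> j = -1"
      using e by (auto simp: signs_def PiE_iff)
    then show ?thesis
      using P(1)[OF r \<open>x \<in> X\<close>] Q(1)[OF r \<open>x \<in> X\<close>] insert.hyps
      by (auto simp: H_def algebra_simps)
  qed
  ultimately show ?case by blast
qed

section \<open>Expected suprema of Rademacher sums\<close>

text \<open>
  This says that the expectation of \<open>sup\<^sub>x\<^sub>\<in>\<^sub>X \<bar>\<Sum>j\<in>J. r\<^sub>j u\<^sub>j(x)\<bar>\<close> is at most \<open>c\<close>. It is phrased through a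
  majorant \<open>H\<close> of the suprema instead of the suprema themselves, which keeps everything in the
  reals and lets majorants be added and scaled. The condition \<open>0 \<le> H \<epsilon>\<close> has content for empty \<open>X\<close>,
  where the supremum is to be \<open>0\<close>.
\<close>

definition rademacher_sup_le :: "'i set \<Rightarrow> 'x set \<Rightarrow> ('i \<Rightarrow> 'x \<Rightarrow> complex) \<Rightarrow> real \<Rightarrow> bool" where
  "rademacher_sup_le J X u c \<longleftrightarrow>
     (\<exists>H. (\<forall>\<epsilon>\<in>signs J. 0 \<le> H \<epsilon> \<and> (\<forall>x\<in>X. cmod (\<Sum>j\<in>J. of_real (\<epsilon> j) * u j x) \<le> H \<epsilon>)) \<and>
          sum H (signs J) \<le> 2 ^ card J * c)"

lemma rademacher_sup_le_mono:
  assumes "rademacher_sup_le J X u c" "c \<le> d"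
  shows "rademacher_sup_le J X u d"
proof -
  have "2 ^ card J * c \<le> 2 ^ card J * d"
    using assms(2) by (rule mult_left_mono) simp
  then show ?thesis
    using assms(1) unfolding rademacher_sup_le_def by (meson order_trans)
qed

lemma rademacher_sup_le_add:
  assumes "rademacher_sup_le J X u c" "rademacher_sup_le J X v d"
  shows "rademacher_sup_le J X (\<lambda>j x. u j x + v j x) (c + d)"
proof -
  obtain H where H: "\<forall>\<epsilon>\<in>signs J. 0 \<le> H \<epsilon> \<and> (\<forall>x\<in>X. cmod (\<Sum>j\<in>J. of_real (\<epsilon> j) * u j x) \<le> H \<epsilon>)"
    "sum H (signs J) \<le> 2 ^ card J * c"
    using assms(1) by (auto simp: rademacher_sup_le_def)
  obtain K where K: "\<forall>\<epsilon>\<in>signs J. 0 \<le> K \<epsilon> \<and> (\<forall>x\<in>X. cmod (\<Sum>j\<in>J. of_real (\<epsilon> j) * v j x) \<le> K \<epsilon>)"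
    "sum K (signs J) \<le> 2 ^ card J * d"
    using assms(2) by (auto simp: rademacher_sup_le_def)
  have "cmod (\<Sum>j\<in>J. of_real (\<epsilon> j) * (u j x + v j x)) \<le> H \<epsilon> + K \<epsilon>" if "\<epsilon> \<in> signs J" "x \<in> X" for \<epsilon> x
    using H(1) K(1) that unfolding distrib_left sum.distrib
    by (intro order_trans[OF norm_triangle_ineq] add_mono) auto
  then show ?thesis
    using H K unfolding rademacher_sup_le_def
    by (intro exI[of _ "\<lambda>\<epsilon>. H \<epsilon> + K \<epsilon>"]) (auto simp: sum.distrib distrib_left)
qed

text \<open>
  Real linearity suffices because the signs are real; so this covers real and imaginary parts
  besides multiplication by a complex constant.
\<close>

lemma rademacher_sup_le_linear_image:
  assumes "rademacher_sup_le J X u c"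
    and f: "linear f" "\<And>z. cmod (f z) \<le> b * cmod z" and b: "0 \<le> b"
  shows "rademacher_sup_le J X (\<lambda>j x. f (u j x)) (b * c)"
proof -
  obtain H where H: "\<forall>\<epsilon>\<in>signs J. 0 \<le> H \<epsilon> \<and> (\<forall>x\<in>X. cmod (\<Sum>j\<in>J. of_real (\<epsilon> j) * u j x) \<le> H \<epsilon>)"
    "sum H (signs J) \<le> 2 ^ card J * c"
    using assms(1) by (auto simp: rademacher_sup_le_def)
  have "cmod (\<Sum>j\<in>J. of_real (\<epsilon> j) * f (u j x)) \<le> b * H \<epsilon>" if "\<epsilon> \<in> signs J" "x \<in> X" for \<epsilon> x
  proof -
    have "(\<Sum>j\<in>J. of_real (\<epsilon> j) * f (u j x)) = f (\<Sum>j\<in>J. of_real (\<epsilon> j) * u j x)"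
      using linear_scale[OF f(1)] by (simp add: linear_sum[OF f(1)] scaleR_conv_of_real)
    also have "cmod \<dots> \<le> b * cmod (\<Sum>j\<in>J. of_real (\<epsilon> j) * u j x)" by (rule f)
    also have "\<dots> \<le> b * H \<epsilon>" using H that b by (intro mult_left_mono) auto
    finally show ?thesis .
  qed
  then show ?thesis
    using H b unfolding rademacher_sup_le_def
    by (intro exI[of _ "\<lambda>\<epsilon>. b * H \<epsilon>"])
      (auto simp: sum_distrib_left[symmetric] mult_left_mono mult.left_commute)
qed

lemma rademacher_sup_le_cmult:
  assumes "rademacher_sup_le J X u c"
  shows "rademacher_sup_le J X (\<lambda>j x. z * u j x) (cmod z * c)"
  using assms by (rule rademacher_sup_le_linear_image)
    (auto simp: norm_mult bounded_linear_mult_right bounded_linear.linear)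

text \<open>
  Absolute values cost the factor \<open>2\<close>: the suprema of \<open>\<Sum>j. \<epsilon>\<^sub>j u\<^sub>j\<close> and \<open>- \<Sum>j. \<epsilon>\<^sub>j u\<^sub>j\<close> are bounded
  separately, and once both bounds are nonnegative their sum bounds the absolute value.
  Nonnegativity comes from adjoining to \<open>X\<close> a point at which all functions vanish; the comparison
  with this point is the condition \<open>\<bar>u\<^sub>j x\<bar> \<le> \<bar>v\<^sub>j x\<bar>\<close>.
\<close>

lemma rademacher_sup_le_contraction:
  fixes u v :: "'i \<Rightarrow> 'x \<Rightarrow> real"
  assumes "finite J" and v: "rademacher_sup_le J X (\<lambda>j x. of_real (v j x)) c"
    and lip: "\<And>j x y. j \<in> J \<Longrightarrow> x \<in> X \<Longrightarrow> y \<in> X \<Longrightarrow> \<bar>u j x - u j y\<bar> \<le> \<bar>v j x - v j y\<bar>"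
    and zero: "\<And>j x. j \<in> J \<Longrightarrow> x \<in> X \<Longrightarrow> \<bar>u j x\<bar> \<le> \<bar>v j x\<bar>"
  shows "rademacher_sup_le J X (\<lambda>j x. of_real (u j x)) (2 * c)"
proof -
  have cmod_eq: "cmod (\<Sum>j\<in>J. complex_of_real (\<epsilon> j) * of_real (f j x)) = \<bar>\<Sum>j\<in>J. \<epsilon> j * f j x\<bar>"
    for \<epsilon> x and f :: "'i \<Rightarrow> 'x \<Rightarrow> real"
    unfolding of_real_mult[symmetric] of_real_sum[symmetric] norm_of_real ..
  obtain G where G: "\<And>\<epsilon>. \<epsilon> \<in> signs J \<Longrightarrow> 0 \<le> G \<epsilon>"
    "\<And>\<epsilon> x. \<epsilon> \<in> signs J \<Longrightarrow> x \<in> X \<Longrightarrow> \<bar>\<Sum>j\<in>J. \<epsilon> j * v j x\<bar> \<le> G \<epsilon>"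
    "sum G (signs J) \<le> 2 ^ card J * c"
    using v unfolding rademacher_sup_le_def cmod_eq by blast
  have one_sided: "\<exists>H. (\<forall>\<epsilon>\<in>signs J. 0 \<le> H \<epsilon> \<and> (\<forall>x\<in>X. (\<Sum>j\<in>J. \<epsilon> j * u' j x) \<le> H \<epsilon>)) \<and>
      sum H (signs J) \<le> sum G (signs J)"
    if "\<And>j x y. j \<in> J \<Longrightarrow> x \<in> X \<Longrightarrow> y \<in> X \<Longrightarrow> \<bar>u' j x - u' j y\<bar> \<le> \<bar>v j x - v j y\<bar>"
       "\<And>j x. j \<in> J \<Longrightarrow> x \<in> X \<Longrightarrow> \<bar>u' j x\<bar> \<le> \<bar>v j x\<bar>" for u' :: "'i \<Rightarrow> 'x \<Rightarrow> real"
  proof -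
    (* None is the adjoined point, where every function takes the value 0 *)
    let ?ext = "\<lambda>f :: 'i \<Rightarrow> 'x \<Rightarrow> real. \<lambda>j. case_option 0 (f j)"
    have "\<exists>H. (\<forall>\<epsilon>\<in>signs J. \<forall>x\<in>insert None (Some ` X). 0 + (\<Sum>j\<in>J. \<epsilon> j * ?ext u' j x) \<le> H \<epsilon>) \<and>
             sum H (signs J) \<le> sum G (signs J)"
    proof (rule contraction_one_sided[where v = "?ext v"])
      fix \<epsilon> x assume "\<epsilon> \<in> signs J" "x \<in> insert None (Some ` X)"
      then show "0 + (\<Sum>j\<in>J. \<epsilon> j * ?ext v j x) \<le> G \<epsilon>"
        using G(1,2)[of \<epsilon>] by (auto simp: abs_le_iff)
    qed (use that \<open>finite J\<close> in auto)
    then show ?thesis by simp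
  qed
  obtain P where P: "\<forall>\<epsilon>\<in>signs J. 0 \<le> P \<epsilon> \<and> (\<forall>x\<in>X. (\<Sum>j\<in>J. \<epsilon> j * u j x) \<le> P \<epsilon>)"
      "sum P (signs J) \<le> sum G (signs J)"
    using one_sided[of u] lip zero by blast
  have "\<exists>H. (\<forall>\<epsilon>\<in>signs J. 0 \<le> H \<epsilon> \<and> (\<forall>x\<in>X. (\<Sum>j\<in>J. \<epsilon> j * (- u j x)) \<le> H \<epsilon>)) \<and>
      sum H (signs J) \<le> sum G (signs J)"
  proof (rule one_sided)
    show "\<bar>- u j x - - u j y\<bar> \<le> \<bar>v j x - v j y\<bar>" if "j \<in> J" "x \<in> X" "y \<in> X" for j x y
      using lip[OF that] by linarith
  qed (use zero in simp)
  then obtain Q where Q: "\<forall>\<epsilon>\<in>signs J. 0 \<le> Q \<epsilon> \<and> (\<forall>x\<in>X. (\<Sum>j\<in>J. \<epsilon> j * (- u j x)) \<le> Q \<epsilon>)"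
      "sum Q (signs J) \<le> sum G (signs J)"
    by (elim exE conjE)
  have "\<bar>\<Sum>j\<in>J. \<epsilon> j * u j x\<bar> \<le> P \<epsilon> + Q \<epsilon>" if "\<epsilon> \<in> signs J" "x \<in> X" for \<epsilon> x
    using P(1) Q(1) that by (force simp: sum_negf abs_le_iff)
  then show ?thesis
    using P Q G(3) unfolding rademacher_sup_le_def cmod_eq
    by (intro exI[of _ "\<lambda>\<epsilon>. P \<epsilon> + Q \<epsilon>"]) (auto simp: sum.distrib)
qed

section \<open>Products of bounded families\<close>

text \<open>
  The map \<open>t \<mapsto> t\<^sup>2\<close> vanishes at \<open>0\<close> and has Lipschitz constant \<open>2 b\<close> on \<open>[-b, b]\<close>; contraction gives
  the other factor \<open>2\<close>. The weights \<open>\<alpha>\<close> stay outside the square, which is why they are kept apart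
  from \<open>u\<close>.
\<close>

lemma rademacher_sup_le_square:
  fixes u :: "'i \<Rightarrow> 'x \<Rightarrow> real"
  assumes "finite J" and \<alpha>: "\<And>j. j \<in> J \<Longrightarrow> 0 \<le> \<alpha> j"
    and u: "rademacher_sup_le J X (\<lambda>j x. of_real (\<alpha> j * u j x)) c"
    and bd: "\<And>j x. j \<in> J \<Longrightarrow> x \<in> X \<Longrightarrow> \<bar>u j x\<bar> \<le> b" and b: "0 \<le> b"
  shows "rademacher_sup_le J X (\<lambda>j x. of_real (\<alpha> j * (u j x)\<^sup>2)) (4 * b * c)"
proof -
  have "rademacher_sup_le J X (\<lambda>j x. of_real (2 * b * (\<alpha> j * u j x))) (2 * b * c)"
    using rademacher_sup_le_cmult[OF u, of "of_real (2 * b)"] b by (simp add: norm_mult)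
  then have "rademacher_sup_le J X (\<lambda>j x. of_real (\<alpha> j * (u j x)\<^sup>2)) (2 * (2 * b * c))"
  proof (rule rademacher_sup_le_contraction[OF \<open>finite J\<close>])
    have main: "\<bar>\<alpha> j * s\<^sup>2 - \<alpha> j * t\<^sup>2\<bar> \<le> \<bar>2 * b * (\<alpha> j * s) - 2 * b * (\<alpha> j * t)\<bar>"
      if "j \<in> J" "\<bar>s\<bar> \<le> b" "\<bar>t\<bar> \<le> b" for j s t
    proof -
      have "\<bar>\<alpha> j * s\<^sup>2 - \<alpha> j * t\<^sup>2\<bar> = \<alpha> j * \<bar>s - t\<bar> * \<bar>s + t\<bar>"
      proof -
        have "\<alpha> j * s\<^sup>2 - \<alpha> j * t\<^sup>2 = \<alpha> j * ((s - t) * (s + t))"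
          by (simp add: power2_eq_square algebra_simps)
        then show ?thesis using \<alpha>[OF that(1)] by (simp add: abs_mult)
      qed
      also have "\<dots> \<le> \<alpha> j * \<bar>s - t\<bar> * (2 * b)"
        using that \<alpha>[OF that(1)] by (intro mult_left_mono) auto
      also have "\<dots> = \<bar>2 * b * (\<alpha> j * s) - 2 * b * (\<alpha> j * t)\<bar>"
      proof -
        have "2 * b * (\<alpha> j * s) - 2 * b * (\<alpha> j * t) = (2 * b * \<alpha> j) * (s - t)"
          by (simp add: algebra_simps)
        then show ?thesis using \<alpha>[OF that(1)] b by (simp add: abs_mult)
      qed
      finally show ?thesis .
    qed
    show "\<bar>\<alpha> j * (u j x)\<^sup>2 - \<alpha> j * (u j y)\<^sup>2\<bar> \<le> \<bar>2 * b * (\<alpha> j * u j x) - 2 * b * (\<alpha> j * u j y)\<bar>"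
      if "j \<in> J" "x \<in> X" "y \<in> X" for j x y
      using that bd by (intro main) auto
    show "\<bar>\<alpha> j * (u j x)\<^sup>2\<bar> \<le> \<bar>2 * b * (\<alpha> j * u j x)\<bar>" if "j \<in> J" "x \<in> X" for j x
      using main[of j "u j x" 0] that bd b by auto
  qed
  then show ?thesis by (simp add: mult.assoc)
qed

text \<open>
  Polarization, \<open>u v = (u + v)\<^sup>2 / 4 - (u - v)\<^sup>2 / 4\<close>. For a tensor product, functions on
  different copies of a space enter as functions on the product space.
\<close>

lemma rademacher_sup_le_mult_real:
  fixes u v :: "'i \<Rightarrow> 'x \<Rightarrow> real"
  assumes "finite J" and \<alpha>: "\<And>j. j \<in> J \<Longrightarrow> 0 \<le> \<alpha> j"
    and u: "rademacher_sup_le J X (\<lambda>j x. of_real (\<alpha> j * u j x)) c"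
    and v: "rademacher_sup_le J X (\<lambda>j x. of_real (\<alpha> j * v j x)) d"
    and bd: "\<And>j x. j \<in> J \<Longrightarrow> x \<in> X \<Longrightarrow> \<bar>u j x\<bar> \<le> 1" "\<And>j x. j \<in> J \<Longrightarrow> x \<in> X \<Longrightarrow> \<bar>v j x\<bar> \<le> 1"
  shows "rademacher_sup_le J X (\<lambda>j x. of_real (\<alpha> j * (u j x * v j x))) (4 * (c + d))"
proof -
  have sum: "rademacher_sup_le J X (\<lambda>j x. of_real (\<alpha> j * (u j x + v j x))) (c + d)"
    using rademacher_sup_le_add[OF u v] by (simp add: distrib_left)
  have p: "rademacher_sup_le J X (\<lambda>j x. of_real (\<alpha> j * (u j x + v j x)\<^sup>2)) (4 * 2 * (c + d))"
  proof (rule rademacher_sup_le_square[OF \<open>finite J\<close> _ sum _ zero_le_numeral])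
    show "\<bar>u j x + v j x\<bar> \<le> 2" if "j \<in> J" "x \<in> X" for j x
      using bd[OF that] by linarith
  qed (rule \<alpha>)
  have diff: "rademacher_sup_le J X (\<lambda>j x. of_real (\<alpha> j * (u j x - v j x))) (c + d)"
    using rademacher_sup_le_add[OF u rademacher_sup_le_cmult[OF v, of "-1"]]
    by (simp add: right_diff_distrib)
  have m: "rademacher_sup_le J X (\<lambda>j x. of_real (\<alpha> j * (u j x - v j x)\<^sup>2)) (4 * 2 * (c + d))"
  proof (rule rademacher_sup_le_square[OF \<open>finite J\<close> _ diff _ zero_le_numeral])
    show "\<bar>u j x - v j x\<bar> \<le> 2" if "j \<in> J" "x \<in> X" for j x
      using bd[OF that] by linarith
  qed (rule \<alpha>)
  have "rademacher_sup_le J X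
      (\<lambda>j x. 1/4 * of_real (\<alpha> j * (u j x + v j x)\<^sup>2) + -1/4 * of_real (\<alpha> j * (u j x - v j x)\<^sup>2))
      (cmod (1/4) * (4 * 2 * (c + d)) + cmod (-1/4) * (4 * 2 * (c + d)))"
    by (intro rademacher_sup_le_add rademacher_sup_le_cmult p m)
  also have "cmod (1/4) * (4 * 2 * (c + d)) + cmod (-1/4) * (4 * 2 * (c + d)) = 4 * (c + d)"
    by simp
  also have "(\<lambda>j x. 1/4 * complex_of_real (\<alpha> j * (u j x + v j x)\<^sup>2) +
       -1/4 * complex_of_real (\<alpha> j * (u j x - v j x)\<^sup>2)) = (\<lambda>j x. of_real (\<alpha> j * (u j x * v j x)))"
    by (auto simp: power2_eq_square algebra_simps)
  finally show ?thesis .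
qed

lemma rademacher_sup_le_mult:
  fixes u v :: "'i \<Rightarrow> 'x \<Rightarrow> complex"
  assumes "finite J" and \<alpha>: "\<And>j. j \<in> J \<Longrightarrow> 0 \<le> \<alpha> j"
    and u: "rademacher_sup_le J X (\<lambda>j x. of_real (\<alpha> j) * u j x) c"
    and v: "rademacher_sup_le J X (\<lambda>j x. of_real (\<alpha> j) * v j x) d"
    and bd: "\<And>j x. j \<in> J \<Longrightarrow> x \<in> X \<Longrightarrow> cmod (u j x) \<le> 1" "\<And>j x. j \<in> J \<Longrightarrow> x \<in> X \<Longrightarrow> cmod (v j x) \<le> 1"
  shows "rademacher_sup_le J X (\<lambda>j x. of_real (\<alpha> j) * (u j x * v j x)) (16 * (c + d))"
proof -
  have Re: "rademacher_sup_le J X (\<lambda>j x. of_real (\<alpha> j * Re (f j x))) e"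
    if "rademacher_sup_le J X (\<lambda>j x. of_real (\<alpha> j) * f j x) e" for f e
  proof -
    have "linear (\<lambda>z. complex_of_real (Re z))"
      by (intro linearI) (simp_all add: scaleR_conv_of_real)
    from rademacher_sup_le_linear_image[OF that this, of 1]
    show ?thesis by (simp add: abs_Re_le_cmod)
  qed
  have Im: "rademacher_sup_le J X (\<lambda>j x. of_real (\<alpha> j * Im (f j x))) e"
    if "rademacher_sup_le J X (\<lambda>j x. of_real (\<alpha> j) * f j x) e" for f e
  proof -
    have "linear (\<lambda>z. complex_of_real (Im z))"
      by (intro linearI) (simp_all add: scaleR_conv_of_real)
    from rademacher_sup_le_linear_image[OF that this, of 1]
    show ?thesis by (simp add: abs_Im_le_cmod)
  qed
  note [intro] = order_trans[OF abs_Re_le_cmod] order_trans[OF abs_Im_le_cmod]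
  note mult = rademacher_sup_le_mult_real[OF \<open>finite J\<close> \<alpha>]
  have rr: "rademacher_sup_le J X (\<lambda>j x. of_real (\<alpha> j * (Re (u j x) * Re (v j x)))) (4 * (c + d))"
    by (rule mult) (use Re[OF u] Re[OF v] bd in auto)
  have ii: "rademacher_sup_le J X (\<lambda>j x. of_real (\<alpha> j * (Im (u j x) * Im (v j x)))) (4 * (c + d))"
    by (rule mult) (use Im[OF u] Im[OF v] bd in auto)
  have ri: "rademacher_sup_le J X (\<lambda>j x. of_real (\<alpha> j * (Re (u j x) * Im (v j x)))) (4 * (c + d))"
    by (rule mult) (use Re[OF u] Im[OF v] bd in auto)
  have ir: "rademacher_sup_le J X (\<lambda>j x. of_real (\<alpha> j * (Im (u j x) * Re (v j x)))) (4 * (c + d))"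
    by (rule mult) (use Im[OF u] Re[OF v] bd in auto)
  let ?w = "\<lambda>j x. (of_real (\<alpha> j * (Re (u j x) * Re (v j x))) +
                   -1 * of_real (\<alpha> j * (Im (u j x) * Im (v j x)))) +
                  (\<i> * of_real (\<alpha> j * (Re (u j x) * Im (v j x))) +
                   \<i> * of_real (\<alpha> j * (Im (u j x) * Re (v j x))))"
  have "rademacher_sup_le J X ?w
      ((4 * (c + d) + cmod (-1) * (4 * (c + d))) +
       (cmod \<i> * (4 * (c + d)) + cmod \<i> * (4 * (c + d))))"
    by (intro rademacher_sup_le_add rademacher_sup_le_cmult rr ii ri ir)
  also have "?w = (\<lambda>j x. of_real (\<alpha> j) * (u j x * v j x))"
    by (intro ext) (simp add: complex_eq_iff algebra_simps)
  finally show ?thesis by simp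
qed

lemma rademacher_sup_le_prod:
  fixes t :: "'s \<Rightarrow> 'i \<Rightarrow> 'x \<Rightarrow> complex"
  assumes "finite S" "S \<noteq> {}"
    and "finite J" and \<alpha>: "\<And>j. j \<in> J \<Longrightarrow> 0 \<le> \<alpha> j" and c: "0 \<le> c"
    and t: "\<And>s. s \<in> S \<Longrightarrow> rademacher_sup_le J X (\<lambda>j x. of_real (\<alpha> j) * t s j x) c"
    and bd: "\<And>s j x. s \<in> S \<Longrightarrow> j \<in> J \<Longrightarrow> x \<in> X \<Longrightarrow> cmod (t s j x) \<le> 1"
  shows "rademacher_sup_le J X (\<lambda>j x. of_real (\<alpha> j) * (\<Prod>s\<in>S. t s j x)) (32 ^ card S * c)"
  using assms(1,2) t bd
proof (induction S rule: finite_ne_induct)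
  case (singleton s)
  then have "rademacher_sup_le J X (\<lambda>j x. of_real (\<alpha> j) * t s j x) c" by simp
  then have "rademacher_sup_le J X (\<lambda>j x. of_real (\<alpha> j) * t s j x) (32 * c)"
    by (rule rademacher_sup_le_mono) (use c in simp)
  then show ?case by simp
next
  case (insert s S)
  have "rademacher_sup_le J X (\<lambda>j x. of_real (\<alpha> j) * (t s j x * (\<Prod>s\<in>S. t s j x)))
          (16 * (c + 32 ^ card S * c))"
  proof (rule rademacher_sup_le_mult[OF \<open>finite J\<close> \<alpha>])
    show "cmod (\<Prod>s\<in>S. t s j x) \<le> 1" if "j \<in> J" "x \<in> X" for j x
      unfolding prod_norm[symmetric] using insert.prems(2) that by (intro prod_le_1) auto
  qed (use insert in auto)
  moreover have "16 * (c + 32 ^ card S * c) \<le> 32 ^ card (insert s S) * c"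
  proof -
    have "c * 1 \<le> c * 32 ^ card S" using c by (intro mult_left_mono) auto
    then show ?thesis using insert.hyps by (simp add: algebra_simps)
  qed
  ultimately show ?case
    using insert.hyps by (auto intro: rademacher_sup_le_mono)
qed

section \<open>Expectations over the Rademacher space\<close>

lemma emeasure_rademacher_cylinder:
  assumes "finite J" "\<epsilon> \<in> signs J"
  shows "{\<omega> \<in> space rademacher_space. \<forall>j\<in>J. \<omega> j = \<epsilon> j} \<in> sets rademacher_space"
    and "emeasure rademacher_space {\<omega> \<in> space rademacher_space. \<forall>j\<in>J. \<omega> j = \<epsilon> j} = 1 / 2 ^ card J"
proof -
  let ?C = "measure_pmf (pmf_of_set {-1, 1 :: real})"
  have eq: "{\<omega> \<in> space rademacher_space. \<forall>j\<in>J. \<omega> j = \<epsilon> j} =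
      prod_emb UNIV (\<lambda>_. ?C) J (\<Pi>\<^sub>E j\<in>J. {\<epsilon> j})"
    by (auto simp: prod_emb_def rademacher_space_def space_PiM PiE_iff)
  show "{\<omega> \<in> space rademacher_space. \<forall>j\<in>J. \<omega> j = \<epsilon> j} \<in> sets rademacher_space"
    unfolding eq unfolding rademacher_space_def using assms(1) by (intro sets_PiM_I) auto
  have "emeasure ?C {\<epsilon> j} = 1 / 2" if "j \<in> J" for j
  proof -
    have "\<epsilon> j \<in> {-1, 1}" using assms(2) that by (auto simp: signs_def)
    then have "measure ?C {\<epsilon> j} = 1 / 2" by (auto simp: measure_pmf_single)
    then have "emeasure ?C {\<epsilon> j} = ennreal (1 / 2)"
      by (simp only: measure_pmf.emeasure_eq_measure)
    also have "\<dots> = 1 / 2" using divide_ennreal[of 1 2] by simp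
    finally show ?thesis .
  qed
  then have "emeasure rademacher_space (prod_emb UNIV (\<lambda>_. ?C) J (\<Pi>\<^sub>E j\<in>J. {\<epsilon> j})) = (1 / 2) ^ card J"
    unfolding rademacher_space_def using assms(1)
    by (subst emeasure_PiM_emb) (auto simp: prob_space_measure_pmf)
  also have "\<dots> = 1 / 2 ^ card J"
    by (simp add: power_divide_distrib_ennreal)
  finally show "emeasure rademacher_space {\<omega> \<in> space rademacher_space. \<forall>j\<in>J. \<omega> j = \<epsilon> j} = 1 / 2 ^ card J"
    unfolding eq .
qed

lemma AE_rademacher: "AE \<omega> in rademacher_space. \<omega> j \<in> {-1, 1}"
  unfolding rademacher_space_def
  by (rule AE_PiM_component) (auto simp: prob_space_measure_pmf AE_measure_pmf_iff)

text \<open>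
  Almost every \<open>\<omega>\<close> takes values \<open>\<plusminus>1\<close> on \<open>J\<close> and so lies in exactly one of the \<open>2 ^ card J\<close> cylinders,
  on which \<open>F\<close> is constant.
\<close>

lemma nn_integral_rademacher:
  fixes F :: "('i \<Rightarrow> real) \<Rightarrow> ennreal"
  assumes "finite J" and F: "\<And>\<omega> \<omega>'. (\<And>j. j \<in> J \<Longrightarrow> \<omega> j = \<omega>' j) \<Longrightarrow> F \<omega> = F \<omega>'"
  shows "(\<integral>\<^sup>+\<omega>. F \<omega> \<partial>rademacher_space) = (\<Sum>\<epsilon>\<in>signs J. F \<epsilon>) / 2 ^ card J"
proof -
  let ?cyl = "\<lambda>\<epsilon>. {\<omega> \<in> space rademacher_space. \<forall>j\<in>J. \<omega> j = \<epsilon> j}"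
  have "AE \<omega> in rademacher_space. \<forall>j\<in>J. \<omega> j \<in> {-1, 1 :: real}"
    by (rule AE_finite_allI[OF \<open>finite J\<close>]) (rule AE_rademacher)
  then have "AE \<omega> in rademacher_space. F \<omega> = (\<Sum>\<epsilon>\<in>signs J. F \<epsilon> * indicator (?cyl \<epsilon>) \<omega>)"
  proof (rule AE_mp[OF _ AE_I2], intro impI)
    fix \<omega> :: "'i \<Rightarrow> real" assume sp: "\<omega> \<in> space rademacher_space" and \<omega>: "\<forall>j\<in>J. \<omega> j \<in> {-1, 1}"
    let ?r = "restrict \<omega> J"
    have "F \<epsilon> * indicator (?cyl \<epsilon>) \<omega> = (if \<epsilon> = ?r then F \<omega> else 0)" if "\<epsilon> \<in> signs J" for \<epsilon>
    proof -
      have "(\<forall>j\<in>J. \<omega> j = \<epsilon> j) \<longleftrightarrow> \<epsilon> = ?r"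
        using that by (auto simp: signs_def PiE_iff extensional_def restrict_def)
      then show ?thesis using sp F[of ?r \<omega>] by (simp add: indicator_def)
    qed
    moreover have "?r \<in> signs J" using \<omega> by (auto simp: signs_def PiE_iff)
    ultimately show "F \<omega> = (\<Sum>\<epsilon>\<in>signs J. F \<epsilon> * indicator (?cyl \<epsilon>) \<omega>)"
      using \<open>finite J\<close> by (simp add: sum.delta')
  qed
  then have "(\<integral>\<^sup>+\<omega>. F \<omega> \<partial>rademacher_space) =
      (\<integral>\<^sup>+\<omega>. (\<Sum>\<epsilon>\<in>signs J. F \<epsilon> * indicator (?cyl \<epsilon>) \<omega>) \<partial>rademacher_space)"
    by (rule nn_integral_cong_AE)
  also have "\<dots> = (\<Sum>\<epsilon>\<in>signs J. \<integral>\<^sup>+\<omega>. F \<epsilon> * indicator (?cyl \<epsilon>) \<omega> \<partial>rademacher_space)"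
    using emeasure_rademacher_cylinder(1)[OF \<open>finite J\<close>] by (intro nn_integral_sum) auto
  also have "\<dots> = (\<Sum>\<epsilon>\<in>signs J. F \<epsilon> * (1 / 2 ^ card J))"
    using emeasure_rademacher_cylinder[OF \<open>finite J\<close>]
    by (intro sum.cong) (auto simp: nn_integral_cmult_indicator)
  also have "\<dots> = (\<Sum>\<epsilon>\<in>signs J. F \<epsilon>) / 2 ^ card J"
    by (simp add: divide_ennreal_def sum_distrib_right)
  finally show ?thesis .
qed

lemma nn_integral_rademacher_Linfty:
  assumes "finite J"
  shows "(\<integral>\<^sup>+\<omega>. Linfty_norm M (\<lambda>x. \<Sum>j\<in>J. of_real (\<omega> j) * u j x) \<partial>rademacher_space) =
         (\<Sum>\<epsilon>\<in>signs J. Linfty_norm M (\<lambda>x. \<Sum>j\<in>J. of_real (\<epsilon> j) * u j x)) / 2 ^ card J"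
  using assms
proof (rule nn_integral_rademacher)
  fix \<omega> \<omega>' :: "'a \<Rightarrow> real" assume "\<And>j. j \<in> J \<Longrightarrow> \<omega> j = \<omega>' j"
  then show "Linfty_norm M (\<lambda>x. \<Sum>j\<in>J. of_real (\<omega> j) * u j x) =
      Linfty_norm M (\<lambda>x. \<Sum>j\<in>J. of_real (\<omega>' j) * u j x)"
    by (simp cong: sum.cong)
qed

section \<open>Essential suprema and suprema over sets of full measure\<close>

lemma expected_Linfty_le:
  assumes "finite J" and u: "rademacher_sup_le J X u c"
    and X: "AE x in M. x \<in> X" and meas: "\<And>j. j \<in> J \<Longrightarrow> u j \<in> borel_measurable M"
  shows "(\<integral>\<^sup>+\<omega>. Linfty_norm M (\<lambda>x. \<Sum>j\<in>J. of_real (\<omega> j) * u j x) \<partial>rademacher_space) \<le> ennreal c"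
proof -
  obtain H where H: "\<And>\<epsilon>. \<epsilon> \<in> signs J \<Longrightarrow> 0 \<le> H \<epsilon>"
    "\<And>\<epsilon> x. \<epsilon> \<in> signs J \<Longrightarrow> x \<in> X \<Longrightarrow> cmod (\<Sum>j\<in>J. of_real (\<epsilon> j) * u j x) \<le> H \<epsilon>"
    "sum H (signs J) \<le> 2 ^ card J * c"
    using u by (auto simp: rademacher_sup_le_def)
  have "Linfty_norm M (\<lambda>x. \<Sum>j\<in>J. of_real (\<epsilon> j) * u j x) \<le> ennreal (H \<epsilon>)" if e: "\<epsilon> \<in> signs J" for \<epsilon>
    unfolding Linfty_norm_def
  proof (rule esssup_I)
    have "(\<lambda>x. \<Sum>j\<in>J. of_real (\<epsilon> j) * u j x) \<in> borel_measurable M"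
      by (intro borel_measurable_sum borel_measurable_times meas) auto
    then show "(\<lambda>x. ennreal (cmod (\<Sum>j\<in>J. of_real (\<epsilon> j) * u j x))) \<in> borel_measurable M"
      by measurable
    show "AE x in M. ennreal (cmod (\<Sum>j\<in>J. of_real (\<epsilon> j) * u j x)) \<le> ennreal (H \<epsilon>)"
      using X H(2)[OF e] by (auto intro: ennreal_leI)
  qed
  then have "(\<Sum>\<epsilon>\<in>signs J. Linfty_norm M (\<lambda>x. \<Sum>j\<in>J. of_real (\<epsilon> j) * u j x)) \<le> (\<Sum>\<epsilon>\<in>signs J. ennreal (H \<epsilon>))"
    by (rule sum_mono)
  also have "\<dots> = ennreal (sum H (signs J))"
    using H(1) by (rule sum_ennreal)
  also have "\<dots> \<le> ennreal (2 ^ card J * c)"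
    using H(3) by (rule ennreal_leI)
  finally have "(\<Sum>\<epsilon>\<in>signs J. Linfty_norm M (\<lambda>x. \<Sum>j\<in>J. of_real (\<epsilon> j) * u j x)) / 2 ^ card J
      \<le> ennreal (2 ^ card J * c) / 2 ^ card J"
    by (rule divide_right_mono_ennreal)
  also have "ennreal (2 ^ card J * c) / 2 ^ card J = ennreal c"
  proof -
    have "ennreal (2 ^ card J * c) = ennreal c * 2 ^ card J"
      using ennreal_mult'[of "2 ^ card J" c] by (simp add: mult.commute ennreal_power[symmetric])
    then show ?thesis
      using ennreal_mult_divide_eq[of "2 ^ card J" "ennreal c"] by (simp add: power_eq_top_ennreal)
  qed
  finally show ?thesis
    by (simp add: nn_integral_rademacher_Linfty[OF \<open>finite J\<close>])
qed

text \<open>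
  For the converse, each of the finitely many sign patterns has its own exceptional null set, and
  their union is discarded.
\<close>

lemma expected_Linfty_leD:
  assumes "finite J" and c: "0 \<le> c"
    and le: "(\<integral>\<^sup>+\<omega>. Linfty_norm M (\<lambda>x. \<Sum>j\<in>J. of_real (\<omega> j) * u j x) \<partial>rademacher_space) \<le> ennreal c"
  shows "\<exists>X. (AE x in M. x \<in> X) \<and> rademacher_sup_le J X u c"
proof -
  let ?L = "\<lambda>\<epsilon>. Linfty_norm M (\<lambda>x. \<Sum>j\<in>J. of_real (\<epsilon> j) * u j x)"
  let ?X = "{x. \<forall>\<epsilon>\<in>signs J. ennreal (cmod (\<Sum>j\<in>J. of_real (\<epsilon> j) * u j x)) \<le> ?L \<epsilon>}"
  have "(\<Sum>\<epsilon>\<in>signs J. ?L \<epsilon>) / 2 ^ card J \<le> ennreal c"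
    using le by (simp add: nn_integral_rademacher_Linfty[OF \<open>finite J\<close>])
  then have "2 ^ card J * ((\<Sum>\<epsilon>\<in>signs J. ?L \<epsilon>) / 2 ^ card J) \<le> 2 ^ card J * ennreal c"
    by (rule mult_left_mono) simp
  then have sum: "(\<Sum>\<epsilon>\<in>signs J. ?L \<epsilon>) \<le> ennreal (2 ^ card J * c)"
  proof -
    have "2 ^ card J * (S / 2 ^ card J) = S" for S :: ennreal
      using ennreal_mult_divide_eq[of "2 ^ card J" S]
      by (simp add: ennreal_times_divide mult.commute power_eq_top_ennreal)
    then show "(\<Sum>\<epsilon>\<in>signs J. ?L \<epsilon>) \<le> ennreal (2 ^ card J * c)"
      if "2 ^ card J * ((\<Sum>\<epsilon>\<in>signs J. ?L \<epsilon>) / 2 ^ card J) \<le> 2 ^ card J * ennreal c"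
      using that by (simp add: ennreal_mult' ennreal_power[symmetric])
  qed
  then have fin: "?L \<epsilon> \<noteq> top" if "\<epsilon> \<in> signs J" for \<epsilon>
  proof -
    have "?L \<epsilon> \<le> (\<Sum>\<epsilon>\<in>signs J. ?L \<epsilon>)"
      using that \<open>finite J\<close> by (intro member_le_sum) auto
    with sum have "?L \<epsilon> \<le> ennreal (2 ^ card J * c)" by (rule order_trans[rotated])
    then show ?thesis by (auto simp: top_unique)
  qed
  have "(\<Sum>\<epsilon>\<in>signs J. enn2real (?L \<epsilon>)) \<le> 2 ^ card J * c"
  proof -
    have "ennreal (\<Sum>\<epsilon>\<in>signs J. enn2real (?L \<epsilon>)) = (\<Sum>\<epsilon>\<in>signs J. ?L \<epsilon>)"
      using fin by (subst sum_ennreal[symmetric]) (auto intro!: sum.cong simp: less_top)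
    then have "ennreal (\<Sum>\<epsilon>\<in>signs J. enn2real (?L \<epsilon>)) \<le> ennreal (2 ^ card J * c)"
      using sum by (simp only:)
    then show ?thesis using c by (simp only: ennreal_le_iff mult_nonneg_nonneg zero_le_numeral zero_le_power)
  qed
  moreover have "cmod (\<Sum>j\<in>J. of_real (\<epsilon> j) * u j x) \<le> enn2real (?L \<epsilon>)" if "\<epsilon> \<in> signs J" "x \<in> ?X" for \<epsilon> x
  proof -
    have "ennreal (cmod (\<Sum>j\<in>J. of_real (\<epsilon> j) * u j x)) \<le> ennreal (enn2real (?L \<epsilon>))"
      using that fin[OF that(1)] by (simp add: less_top)
    then show ?thesis by (simp only: ennreal_le_iff enn2real_nonneg)
  qed
  ultimately have "rademacher_sup_le J ?X u c"
    unfolding rademacher_sup_le_def by (intro exI[of _ "\<lambda>\<epsilon>. enn2real (?L \<epsilon>)"]) auto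
  moreover have "AE x in M. \<forall>\<epsilon>\<in>signs J. ennreal (cmod (\<Sum>j\<in>J. of_real (\<epsilon> j) * u j x)) \<le> ?L \<epsilon>"
    unfolding Linfty_norm_def
    by (intro AE_finite_allI finite_signs \<open>finite J\<close>) (rule esssup_AE)
  ultimately show ?thesis
    by (intro exI[of _ ?X]) simp
qed

lemma rademacher_sup_le_reindex:
  assumes "rademacher_sup_le J X u c" "\<And>y. y \<in> Y \<Longrightarrow> g y \<in> X"
  shows "rademacher_sup_le J Y (\<lambda>j y. u j (g y)) c"
  using assms unfolding rademacher_sup_le_def by meson

lemma rademacher_sup_le_cong:
  assumes "rademacher_sup_le J X u c" "\<And>j x. j \<in> J \<Longrightarrow> x \<in> X \<Longrightarrow> u j x = v j x"
  shows "rademacher_sup_le J X v c"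
proof -
  have "(\<Sum>j\<in>J. of_real (\<epsilon> j) * v j x) = (\<Sum>j\<in>J. of_real (\<epsilon> j) * u j x)" if "x \<in> X" for \<epsilon> x
    using assms(2) that by (intro sum.cong) auto
  then show ?thesis
    using assms(1) unfolding rademacher_sup_le_def by simp
qed

lemma uniformly_bounded_systemE:
  assumes "uniformly_bounded_system M \<phi>"
  obtains B where "1 \<le> B" "\<And>j. AE x in M. cmod (\<phi> j x) \<le> B"
proof -
  define S where "S = (SUP j. Linfty_norm M (\<phi> j))"
  have "S < top" using assms by (simp add: uniformly_bounded_system_def S_def)
  show thesis
  proof (rule that[of "max 1 (enn2real S)"])
    fix j
    have "Linfty_norm M (\<phi> j) \<le> S" unfolding S_def by (rule SUP_upper) simp
    then have "AE x in M. ennreal (cmod (\<phi> j x)) \<le> S"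
      using esssup_AE[of "\<lambda>x. ennreal (cmod (\<phi> j x))" M] by (auto simp: Linfty_norm_def)
    then show "AE x in M. cmod (\<phi> j x) \<le> max 1 (enn2real S)"
      using \<open>S < top\<close> by (cases S) (auto simp: ennreal_le_iff le_max_iff_disj)
  qed simp
qed

section \<open>Descent from the tensor system\<close>

text \<open>
  The constant for \<open>\<phi>\<close> is \<open>\<gamma> / (32 B)\<^sup>k\<close>: the factor \<open>32\<^sup>k\<close> is the cost of the \<open>k\<close>-fold product, and
  \<open>B\<^sup>k\<close> that of normalizing the factors to modulus at most \<open>1\<close>.
\<close>

theorem theorem4:
  fixes M :: "'a measure" and \<phi> :: "'i::countable \<Rightarrow> 'a \<Rightarrow> complex" and k :: nat
  assumes "k \<ge> 1"
    and "prob_space M"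
    and "orthonormal_system M \<phi>"
    and "uniformly_bounded_system M \<phi>"
    and "rademacher_sidon (\<Pi>\<^sub>M s\<in>{1..k}. M) (tensor_system k \<phi>)"
  shows "rademacher_sidon M \<phi>"
proof -
  let ?Mk = "\<Pi>\<^sub>M s\<in>{1..k}. M"
  obtain B where B: "1 \<le> B" and bdd: "\<And>j. AE x in M. cmod (\<phi> j x) \<le> B"
    using uniformly_bounded_systemE[OF assms(4)] by blast
  have meas [measurable]: "\<phi> j \<in> borel_measurable M" for j
    using assms(3) by (simp add: orthonormal_system_def)
  obtain \<gamma> where "\<gamma> > 0" and \<gamma>: "\<And>b. finite {j. b j \<noteq> 0} \<Longrightarrow>
      ennreal (\<gamma> * (\<Sum>j | b j \<noteq> 0. cmod (b j))) \<le>
      (\<integral>\<^sup>+\<omega>. Linfty_norm ?Mk (\<lambda>x. \<Sum>j | b j \<noteq> 0. of_real (\<omega> j) * b j * tensor_system k \<phi> j x)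
         \<partial>rademacher_space)"
    using assms(5) unfolding rademacher_sidon_def by blast
  have "ennreal (\<gamma> / (32 * B) ^ k * (\<Sum>j | a j \<noteq> 0. cmod (a j))) \<le>
      (\<integral>\<^sup>+\<omega>. Linfty_norm M (\<lambda>x. \<Sum>j | a j \<noteq> 0. of_real (\<omega> j) * a j * \<phi> j x) \<partial>rademacher_space)"
    (is "_ \<le> ?R") if fin: "finite {j. a j \<noteq> 0}" for a :: "'i \<Rightarrow> complex"
  proof (cases "?R = top")
    case False
    define J where "J = {j. a j \<noteq> 0}"
    have J: "finite J" using fin by (simp add: J_def)
    define r where "r = enn2real ?R"
    have r: "?R = ennreal r" "0 \<le> r" using False by (simp_all add: r_def less_top)
    have "(\<integral>\<^sup>+\<omega>. Linfty_norm M (\<lambda>x. \<Sum>j\<in>J. of_real (\<omega> j) * (a j * \<phi> j x)) \<partial>rademacher_space) \<le> ennreal r"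
      using r by (simp add: J_def mult.assoc)
    from expected_Linfty_leD[OF J r(2) this]
    obtain X0 where X0: "AE x in M. x \<in> X0" "rademacher_sup_le J X0 (\<lambda>j x. a j * \<phi> j x) r"
      by blast
    define X where "X = {x \<in> X0. \<forall>j\<in>J. cmod (\<phi> j x) \<le> B}"
    have "AE x in M. \<forall>j\<in>J. cmod (\<phi> j x) \<le> B"
      using bdd by (intro AE_finite_allI J) auto
    then have AE_X: "AE x in M. x \<in> X" using X0(1) by (auto simp: X_def)
    define Z where "Z = {y. \<forall>s\<in>{1..k}. y s \<in> X}"
    have "AE y in ?Mk. \<forall>s\<in>{1..k}. y s \<in> X"
      using AE_X assms(2) by (intro AE_finite_allI) (auto intro!: AE_PiM_component)
    then have AE_Z: "AE y in ?Mk. y \<in> Z" by (simp add: Z_def)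
    (* the s-th factor of the tensor system, normalized in modulus and with the phase of a j *)
    define t where "t s j y = sgn (a j) * \<phi> j (y s) / of_real B" for s :: nat and j and y :: "nat \<Rightarrow> 'a"
    have factor: "rademacher_sup_le J Z (\<lambda>j y. of_real (cmod (a j)) * t s j y) r"
      if "s \<in> {1..k}" for s
    proof -
      have "rademacher_sup_le J Z (\<lambda>j y. a j * \<phi> j (y s)) r"
        using rademacher_sup_le_reindex[OF X0(2), of Z "\<lambda>y. y s"] that by (simp add: Z_def X_def)
      then have "rademacher_sup_le J Z (\<lambda>j y. of_real (1 / B) * (a j * \<phi> j (y s)))
          (cmod (of_real (1 / B)) * r)"
        by (rule rademacher_sup_le_cmult)
      moreover have "cmod (of_real (1 / B)) * r \<le> 1 * r"
        using B r(2) by (intro mult_right_mono) (auto simp: norm_divide)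
      ultimately have "rademacher_sup_le J Z (\<lambda>j y. of_real (1 / B) * (a j * \<phi> j (y s))) (1 * r)"
        by (rule rademacher_sup_le_mono)
      then have "rademacher_sup_le J Z (\<lambda>j y. of_real (1 / B) * (a j * \<phi> j (y s))) r"
        by simp
      moreover have "of_real (1 / B) * (a j * \<phi> j (y s)) = of_real (cmod (a j)) * t s j y" for j y
        using B by (cases "a j = 0") (simp_all add: t_def sgn_eq)
      ultimately show ?thesis by simp
    qed
    have t_le: "cmod (t s j y) \<le> 1" if "s \<in> {1..k}" "j \<in> J" "y \<in> Z" for s j y
      using that B by (auto simp: t_def norm_mult norm_divide norm_sgn Z_def X_def)
    define b where "b j = of_real (cmod (a j)) * (sgn (a j) / of_real B) ^ k" for j
    have b0: "b j \<noteq> 0 \<longleftrightarrow> a j \<noteq> 0" for j using B by (auto simp: b_def sgn_zero_iff)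
    have cmod_b: "cmod (b j) = cmod (a j) / B ^ k" for j
      using B by (cases "a j = 0")
        (auto simp: b_def norm_mult norm_power norm_divide norm_sgn power_divide)
    have "rademacher_sup_le J Z (\<lambda>j y. of_real (cmod (a j)) * (\<Prod>s\<in>{1..k}. t s j y)) (32 ^ card {1..k} * r)"
      using assms(1) J r(2) factor t_le by (intro rademacher_sup_le_prod) auto
    then have "rademacher_sup_le J Z (\<lambda>j y. b j * tensor_system k \<phi> j y) (32 ^ card {1..k} * r)"
      by (rule rademacher_sup_le_cong)
        (simp add: t_def b_def tensor_system_def prod.distrib prod_dividef power_divide)
    then have "(\<integral>\<^sup>+\<omega>. Linfty_norm ?Mk (\<lambda>y. \<Sum>j\<in>J. of_real (\<omega> j) * (b j * tensor_system k \<phi> j y))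
        \<partial>rademacher_space) \<le> ennreal (32 ^ card {1..k} * r)"
    proof (rule expected_Linfty_le[OF J _ AE_Z])
      have "(\<lambda>y. \<phi> j (y s)) \<in> borel_measurable ?Mk" if "s \<in> {1..k}" for j s
        using measurable_compose[OF measurable_component_singleton[OF that, of "\<lambda>_. M"] meas] .
      then show "(\<lambda>y. b j * tensor_system k \<phi> j y) \<in> borel_measurable ?Mk" for j
        unfolding tensor_system_def by (intro borel_measurable_times borel_measurable_prod) auto
    qed
    then have "ennreal (\<gamma> * (\<Sum>j\<in>J. cmod (b j))) \<le> ennreal (32 ^ k * r)"
      using \<gamma>[of b] J by (simp add: b0 J_def mult.assoc)
    then have "\<gamma> * (\<Sum>j\<in>J. cmod (b j)) \<le> 32 ^ k * r"
      using r(2) by (simp add: ennreal_le_iff)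
    then have "\<gamma> / (32 * B) ^ k * (\<Sum>j\<in>J. cmod (a j)) \<le> r"
      using B by (simp add: cmod_b sum_divide_distrib[symmetric] power_mult_distrib field_simps)
    then show ?thesis
      unfolding r(1) J_def by (rule ennreal_leI)
  qed simp
  moreover have "\<gamma> / (32 * B) ^ k > 0" using \<open>\<gamma> > 0\<close> B by simp
  ultimately show ?thesis
    unfolding rademacher_sidon_def by blast
qed

end
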